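(* Let $C_n$ be the cycle graph on $n$ vertices, with vertex set $[n]=\{1,\dots,n\}$ and adjacency matrix $A_n$. For every valid value of $\alpha$ (i.e., $0<\alpha<1/\rho(A_n)$) the effective resistance, the distance, and the Katz similarity index rank all node pairs of $C_n$ in the same order. That is, \[ K_{C_n}(\alpha)_{i,j}<K_{C_n}(\alpha)_{i',j'}\iff R_{C_n}(i,j)>R_{C_n}(i',j')\iff d_{C_n}(i,j)>d_{C_n}(i',j') \] for all $i,i',j,j'\in[n]$.
   Context: For a simple graph $G$ with adjacency matrix $A$, spectral radius $\rho(A)$, and $0<\alpha<1/\rho(A)$, the Katz matrix is $K_G(\alpha)=\sum_{t=1}^\infty \alpha^tA^t=(I-\alpha A)^{-1}-I$, and the Katz similarity index between vertices $i$ and $j$ is the entry $K_G(\alpha)_{i,j}$. The resistance distance (effective resistance) is $R_G(i,j)=(L_G^\dagger)_{ii}+(L_G^\dagger)_{jj}-2(L_G^\dagger)_{ij}$, where $L_G^\dagger$ is the Moore–Penrose pseudoinverse of the graph Laplacian $L_G$. $d_G(i,j)$ is the usual shortest-path distance. The cycle $C_n$ has edges $\{i,i+1\}$ for $1\le i<n$ and $\{n,1\}$.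
   Formalization: Here n ≥ 3, and the Katz equivalence is claimed only for pairs with i ≠ j and i' ≠ j'; with i = j allowed it fails, since K_{i,i} = 2αK_{i,i+1} < K_{i,i+1} while R(i,i) = 0 < R(i,i+1). The R–d equivalence is for all pairs. *)

theory Defs
  imports "Jordan_Normal_Form.Spectral_Radius" "HOL-Library.Extended_Nat"
begin

text \<open>
  A simple graph on the vertex set \<open>{1..n}\<close> is given by \<open>n\<close> and its set of edges, an edge being
  the two-element set of its end points. Matrices are indexed from \<open>0\<close>, so vertex \<open>i\<close>
  corresponds to row and column \<open>i - 1\<close>.
\<close>

definition simple_graph :: "nat \<Rightarrow> nat set set \<Rightarrow> bool" where
  "simple_graph n E \<longleftrightarrow> E \<subseteq> {{u, v} | u v. u \<in> {1..n} \<and> v \<in> {1..n} \<and> u \<noteq> v}"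

definition cycle_graph :: "nat \<Rightarrow> nat set set" where
  "cycle_graph n = {{i, i + 1} | i. 1 \<le> i \<and> i < n} \<union> {{n, 1}}"

lemma simple_graph_cycle_graph:
  assumes "n \<ge> 3"
  shows "simple_graph n (cycle_graph n)"
proof -
  have "\<exists>u v. {i, i + 1} = {u, v} \<and> u \<in> {1..n} \<and> v \<in> {1..n} \<and> u \<noteq> v"
    if "1 \<le> i" "i < n" for i
    using that by (intro exI[of _ i] exI[of _ "i + 1"]) auto
  moreover have "\<exists>u v. {n, 1} = {u, v} \<and> u \<in> {1..n} \<and> v \<in> {1..n} \<and> u \<noteq> v"
    using assms by (intro exI[of _ n] exI[of _ "1::nat"]) auto
  ultimately show ?thesis
    unfolding simple_graph_def cycle_graph_def by blast
qed

definition adj_matrix :: "nat \<Rightarrow> nat set set \<Rightarrow> real mat" where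
  "adj_matrix n E = mat n n (\<lambda>(i, j). if {i + 1, j + 1} \<in> E then 1 else 0)"

definition degree :: "nat \<Rightarrow> nat set set \<Rightarrow> nat \<Rightarrow> nat" where
  "degree n E v = card {u \<in> {1..n}. {u, v} \<in> E}"

definition laplacian :: "nat \<Rightarrow> nat set set \<Rightarrow> real mat" where
  "laplacian n E =
     mat n n (\<lambda>(i, j). if i = j then real (degree n E (i + 1)) else 0) - adj_matrix n E"

definition graph_spectral_radius :: "nat \<Rightarrow> nat set set \<Rightarrow> real" where
  "graph_spectral_radius n E = spectral_radius (map_mat complex_of_real (adj_matrix n E))"

text \<open>The Katz series, summed entrywise; it starts with the term of exponent \<open>1\<close>.\<close>

definition katz_matrix :: "nat \<Rightarrow> nat set set \<Rightarrow> real \<Rightarrow> real mat" where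
  "katz_matrix n E \<alpha> =
     mat n n (\<lambda>(i, j). \<Sum>t. (\<alpha> ^ Suc t \<cdot>\<^sub>m adj_matrix n E ^\<^sub>m Suc t) $$ (i, j))"

definition katz :: "nat \<Rightarrow> nat set set \<Rightarrow> real \<Rightarrow> nat \<Rightarrow> nat \<Rightarrow> real" where
  "katz n E \<alpha> i j = katz_matrix n E \<alpha> $$ (i - 1, j - 1)"

text \<open>The four Penrose conditions for real matrices.\<close>

definition is_pseudoinverse :: "real mat \<Rightarrow> real mat \<Rightarrow> bool" where
  "is_pseudoinverse A X \<longleftrightarrow>
     X \<in> carrier_mat (dim_col A) (dim_row A) \<and>
     A * X * A = A \<and> X * A * X = X \<and>
     transpose_mat (A * X) = A * X \<and> transpose_mat (X * A) = X * A"

definition pseudoinverse :: "real mat \<Rightarrow> real mat" where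
  "pseudoinverse A = (THE X. is_pseudoinverse A X)"

lemma is_pseudoinverse_unique:
  assumes "is_pseudoinverse A X" and "is_pseudoinverse A Y"
  shows "X = Y"
proof -
  define r c where "r = dim_row A" and "c = dim_col A"
  have A: "A \<in> carrier_mat r c"
    by (simp add: r_def c_def)
  have X: "X \<in> carrier_mat c r" and Y: "Y \<in> carrier_mat c r"
    using assms by (auto simp: is_pseudoinverse_def r_def c_def)
  note x = assms(1)[unfolded is_pseudoinverse_def]
  note y = assms(2)[unfolded is_pseudoinverse_def]
  have "A * X = (A * Y * A) * X"
    using y by simp
  also have "\<dots> = (A * Y) * (A * X)"
    by (rule assoc_mult_mat[of _ r r _ c _ r]) (use A X Y in auto)
  finally have "transpose_mat (A * X) = transpose_mat ((A * Y) * (A * X))"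
    by simp
  also have "\<dots> = transpose_mat (A * X) * transpose_mat (A * Y)"
    by (rule transpose_mult[of _ r r _ r]) (use A X Y in auto)
  finally have "A * X = (A * X) * (A * Y)"
    using x y by simp
  also have "\<dots> = (A * X * A) * Y"
    by (rule assoc_mult_mat[of _ r r _ c _ r, symmetric]) (use A X Y in auto)
  finally have AX: "A * X = A * Y"
    using x by simp
  have "X * A = X * (A * Y * A)"
    using y by simp
  also have "\<dots> = X * (A * (Y * A))"
    by (subst assoc_mult_mat[of A r c Y r A c]) (use A X Y in auto)
  also have "\<dots> = (X * A) * (Y * A)"
    by (rule assoc_mult_mat[of _ c r _ c _ c, symmetric]) (use A X Y in auto)
  finally have "transpose_mat (X * A) = transpose_mat ((X * A) * (Y * A))"
    by simp
  also have "\<dots> = transpose_mat (Y * A) * transpose_mat (X * A)"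
    by (rule transpose_mult[of _ c c _ c]) (use A X Y in auto)
  finally have "X * A = (Y * A) * (X * A)"
    using x y by simp
  also have "\<dots> = Y * (A * (X * A))"
    by (rule assoc_mult_mat[of _ c r _ c _ c]) (use A X Y in auto)
  also have "A * (X * A) = A * X * A"
    by (rule assoc_mult_mat[of _ r c _ r _ c, symmetric]) (use A X Y in auto)
  finally have XA: "X * A = Y * A"
    using x by simp
  have "X = X * A * X"
    using x by simp
  also have "\<dots> = Y * A * X"
    using XA by simp
  also have "\<dots> = Y * (A * X)"
    by (rule assoc_mult_mat[of _ c r _ c _ r]) (use A X Y in auto)
  also have "\<dots> = Y * (A * Y)"
    using AX by simp
  also have "\<dots> = Y * A * Y"
    by (rule assoc_mult_mat[of _ c r _ c _ r, symmetric]) (use A X Y in auto)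
  also have "\<dots> = Y"
    using y by simp
  finally show ?thesis .
qed

lemma pseudoinverse_eqI: "is_pseudoinverse A X \<Longrightarrow> pseudoinverse A = X"
  unfolding pseudoinverse_def by (blast intro: is_pseudoinverse_unique)

definition resistance :: "nat \<Rightarrow> nat set set \<Rightarrow> nat \<Rightarrow> nat \<Rightarrow> real" where
  "resistance n E i j =
     (let P = pseudoinverse (laplacian n E)
      in P $$ (i - 1, i - 1) + P $$ (j - 1, j - 1) - 2 * P $$ (i - 1, j - 1))"

definition is_path :: "nat \<Rightarrow> nat set set \<Rightarrow> nat \<Rightarrow> nat \<Rightarrow> nat list \<Rightarrow> bool" where
  "is_path n E i j p \<longleftrightarrow>
     p \<noteq> [] \<and> hd p = i \<and> last p = j \<and> distinct p \<and> set p \<subseteq> {1..n} \<and>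
     (\<forall>k. Suc k < length p \<longrightarrow> {p ! k, p ! Suc k} \<in> E)"

text \<open>The distance is \<open>\<infinity>\<close> between vertices that no path connects.\<close>

definition graph_dist :: "nat \<Rightarrow> nat set set \<Rightarrow> nat \<Rightarrow> nat \<Rightarrow> enat" where
  "graph_dist n E i j = (INF p \<in> {p. is_path n E i j p}. enat (length p - 1))"

end

theory Submission
  imports Defs
begin

text \<open>
  The adjacency matrix, its powers and the pseudoinverse of the Laplacian are circulant, so all
  three indices depend only on \<open>d = min \<bar>i - j\<bar> (n - \<bar>i - j\<bar>)\<close>, which is the distance. The
  resistance equals \<open>d (n - d) / n\<close>, increasing for \<open>2 d \<le> n\<close>. An entry \<open>G\<close> of
  \<open>(I - \<alpha> A)\<^sup>-\<^sup>1\<close> satisfies \<open>G k = \<alpha> (G (k - 1) + G (k + 1))\<close> for \<open>0 < k < n\<close>; the spectral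
  radius is at least \<open>2\<close>, so \<open>\<alpha> < 1 / 2\<close>, and since \<open>G\<close> is positive it is strictly convex.
  A strictly convex sequence symmetric under \<open>k \<mapsto> n - k\<close> decreases up to \<open>n / 2\<close>.
\<close>

section \<open>Neighbours in the cycle and its adjacency matrix\<close>

definition cycle_dist :: "nat \<Rightarrow> nat \<Rightarrow> nat \<Rightarrow> nat" where
  "cycle_dist n i j = nat (min \<bar>int i - int j\<bar> (int n - \<bar>int i - int j\<bar>))"

definition next_index :: "nat \<Rightarrow> nat \<Rightarrow> nat" where
  "next_index n i = (if Suc i = n then 0 else Suc i)"

definition prev_index :: "nat \<Rightarrow> nat \<Rightarrow> nat" where
  "prev_index n i = (if i = 0 then n - 1 else i - 1)"

lemma edge_cycle_graph_iff:
  assumes "n \<ge> 3" "i < n" "j < n"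
  shows "{i + 1, j + 1} \<in> cycle_graph n \<longleftrightarrow> j = next_index n i \<or> j = prev_index n i"
proof
  assume "{i + 1, j + 1} \<in> cycle_graph n"
  then show "j = next_index n i \<or> j = prev_index n i"
    using assms unfolding cycle_graph_def next_index_def prev_index_def
    by (auto simp: doubleton_eq_iff)
next
  have path_edge: "{a + 1, a + 2} \<in> cycle_graph n" if "Suc a < n" for a
    unfolding cycle_graph_def by (rule UnI1) (use that in \<open>auto intro!: exI[of _ "Suc a"]\<close>)
  have closing_edge: "{n, 1} \<in> cycle_graph n"
    unfolding cycle_graph_def by simp
  assume "j = next_index n i \<or> j = prev_index n i"
  then consider "Suc i < n" "j = Suc i" | "Suc i = n" "j = 0" | "i = 0" "j = n - 1" | "i = Suc j"
    using assms unfolding next_index_def prev_index_def by (auto split: if_splits)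
  then show "{i + 1, j + 1} \<in> cycle_graph n"
  proof cases
    case 1
    then show ?thesis using path_edge[of i] by simp
  next
    case 2
    then show ?thesis using closing_edge by simp
  next
    case 3
    then show ?thesis using closing_edge assms by (simp add: insert_commute)
  next
    case 4
    then show ?thesis using path_edge[of j] assms by (simp add: insert_commute)
  qed
qed

lemma next_index_less: "n \<ge> 3 \<Longrightarrow> i < n \<Longrightarrow> next_index n i < n"
  by (auto simp: next_index_def)

lemma prev_index_less: "n \<ge> 3 \<Longrightarrow> i < n \<Longrightarrow> prev_index n i < n"
  by (auto simp: prev_index_def)

text \<open>With two vertices the successor and the predecessor would coincide;
  \<open>n \<ge> 3\<close> separates them, so that degrees are \<open>2\<close> and neighbour sums
  have two terms.\<close>

lemma next_index_neq_prev_index: "n \<ge> 3 \<Longrightarrow> i < n \<Longrightarrow> next_index n i \<noteq> prev_index n i"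
  by (auto simp: next_index_def prev_index_def)

lemma sum_neighbours_cycle_graph:
  fixes f :: "nat \<Rightarrow> 'a::semiring_1"
  assumes "n \<ge> 3" "i < n"
  shows "(\<Sum>j<n. of_bool ({i + 1, j + 1} \<in> cycle_graph n) * f j)
    = f (next_index n i) + f (prev_index n i)"
proof -
  have "(\<Sum>j<n. of_bool ({i + 1, j + 1} \<in> cycle_graph n) * f j)
      = (\<Sum>j\<in>{next_index n i, prev_index n i}. f j)"
    by (rule sum.mono_neutral_cong_right)
       (use assms edge_cycle_graph_iff[OF assms] next_index_less[OF assms]
          prev_index_less[OF assms] in auto)
  also have "\<dots> = f (next_index n i) + f (prev_index n i)"
    using next_index_neq_prev_index[OF assms] by simp
  finally show ?thesis .
qed

text \<open>Periodicity on \<open>int\<close> absorbs the wrap-around at both ends: the neighbours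
  become \<open>x + 1\<close> and \<open>x - 1\<close> with no case distinction. All later matrix
  computations go through this form.\<close>

lemma sum_neighbours_cycle_graph_periodic:
  fixes f :: "int \<Rightarrow> 'a::semiring_1"
  assumes "n \<ge> 3" "i < n" and per: "\<And>x. f (x + int n) = f x"
  shows "(\<Sum>j<n. of_bool ({i + 1, j + 1} \<in> cycle_graph n) * f (int j))
    = f (int i + 1) + f (int i - 1)"
proof -
  have "f (int (next_index n i)) = f (int i + 1)"
    using per[of 0] by (auto simp: next_index_def add.commute)
  moreover have "f (int (prev_index n i)) = f (int i - 1)"
    using per[of "-1"] assms(1) by (auto simp: prev_index_def of_nat_diff add.commute)
  ultimately show ?thesis
    using sum_neighbours_cycle_graph[OF assms(1,2), of "\<lambda>j. f (int j)"] by simp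
qed

lemma adj_matrix_index:
  "i < n \<Longrightarrow> j < n \<Longrightarrow> adj_matrix n E $$ (i, j) = of_bool ({i + 1, j + 1} \<in> E)"
  by (simp add: adj_matrix_def)

lemma dim_adj_matrix [simp]: "dim_row (adj_matrix n E) = n" "dim_col (adj_matrix n E) = n"
  by (simp_all add: adj_matrix_def)

lemma adj_matrix_carrier [simp]: "adj_matrix n E \<in> carrier_mat n n"
  by (rule carrier_matI) simp_all

lemma degree_cycle_graph:
  assumes "n \<ge> 3" "i < n"
  shows "degree n (cycle_graph n) (i + 1) = 2"
proof -
  have "{u \<in> {1..n}. {u, i + 1} \<in> cycle_graph n}
      = Suc ` {j. j < n \<and> {i + 1, j + 1} \<in> cycle_graph n}"
    unfolding image_Suc_lessThan[symmetric] by (auto simp: insert_commute)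
  also have "{j. j < n \<and> {i + 1, j + 1} \<in> cycle_graph n} = {next_index n i, prev_index n i}"
    using edge_cycle_graph_iff[OF assms] next_index_less[OF assms] prev_index_less[OF assms]
    by auto
  finally show ?thesis
    using next_index_neq_prev_index[OF assms] by (simp add: degree_def card_image)
qed

subsection \<open>Spectral radius\<close>

text \<open>The all-ones vector is an eigenvector for the eigenvalue \<open>2\<close>, since every
  vertex has two neighbours.\<close>

lemma graph_spectral_radius_cycle_graph_ge:
  assumes "n \<ge> 3"
  shows "graph_spectral_radius n (cycle_graph n) \<ge> 2"
proof -
  let ?A = "map_mat complex_of_real (adj_matrix n (cycle_graph n))"
  let ?v = "vec n (\<lambda>_. 1 :: complex)"
  have A: "?A \<in> carrier_mat n n" by simp
  have "?A *\<^sub>v ?v = 2 \<cdot>\<^sub>v ?v"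
  proof (rule eq_vecI)
    fix i assume "i < dim_vec (2 \<cdot>\<^sub>v ?v)"
    then have i: "i < n" by simp
    then have "(?A *\<^sub>v ?v) $ i = (\<Sum>j<n. ?A $$ (i, j))"
      by (simp add: scalar_prod_def atLeast0LessThan)
    also have "\<dots> = (\<Sum>j<n. of_bool ({i + 1, j + 1} \<in> cycle_graph n) * 1)"
      by (rule sum.cong) (use i in \<open>simp_all add: adj_matrix_index\<close>)
    finally show "(?A *\<^sub>v ?v) $ i = (2 \<cdot>\<^sub>v ?v) $ i"
      using sum_neighbours_cycle_graph[OF assms i, of "\<lambda>_. 1 :: complex"] i by simp
  qed simp
  moreover have "?v \<noteq> 0\<^sub>v n"
  proof
    assume "?v = 0\<^sub>v n"
    then have "?v $ 0 = 0\<^sub>v n $ 0" by simp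
    then show False using assms by simp
  qed
  ultimately have "eigenvalue ?A 2"
    unfolding eigenvalue_def eigenvector_def by (intro exI[of _ ?v]) simp
  then have "2 \<in> spectrum ?A" by (simp add: spectrum_def)
  then have "norm (2 :: complex) \<in> norm ` spectrum ?A" by (rule imageI)
  then have "norm (2 :: complex) \<le> spectral_radius ?A"
    unfolding spectral_radius_def using card_finite_spectrum(1)[OF A]
    by (intro Max_ge finite_imageI)
  then show ?thesis by (simp add: graph_spectral_radius_def)
qed

subsection \<open>Distance\<close>

lemma is_path_rev: "is_path n E i j p \<Longrightarrow> is_path n E j i (rev p)"
  unfolding is_path_def
proof (elim conjE, intro conjI allI impI)
  fix k assume e: "\<forall>k. Suc k < length p \<longrightarrow> {p ! k, p ! Suc k} \<in> E" and k: "Suc k < length (rev p)"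
  then have "{p ! (length p - Suc (Suc k)), p ! Suc (length p - Suc (Suc k))} \<in> E"
    by auto
  moreover have "Suc (length p - Suc (Suc k)) = length p - Suc k" using k by simp
  ultimately show "{rev p ! k, rev p ! Suc k} \<in> E"
    using k by (simp add: rev_nth insert_commute)
qed (auto simp: hd_rev last_rev)

lemma graph_dist_sym: "graph_dist n E i j = graph_dist n E j i"
proof -
  have "{p. is_path n E i j p} = rev ` {p. is_path n E j i p}"
    by (auto simp: image_iff intro: is_path_rev) (metis is_path_rev rev_rev_ident)
  then show ?thesis
    by (simp add: graph_dist_def image_image)
qed

lemma cycle_dist_sym: "cycle_dist n i j = cycle_dist n j i"
  by (simp add: cycle_dist_def abs_minus_commute)

text \<open>Makes \<open>cycle_dist n i\<close> a potential growing by at most one per edge, which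
  bounds the length of every path from \<open>i\<close> below.\<close>

lemma cycle_dist_step:
  assumes "i \<in> {1..n}" "u \<in> {1..n}" "v \<in> {1..n}" "{u, v} \<in> cycle_graph n"
  shows "cycle_dist n i v \<le> Suc (cycle_dist n i u)"
proof -
  from assms have "v = u + 1 \<or> u = v + 1 \<or> (u = n \<and> v = 1) \<or> (u = 1 \<and> v = n)"
    unfolding cycle_graph_def by (auto simp: doubleton_eq_iff)
  with assms(1-3) show ?thesis
    unfolding cycle_dist_def by auto
qed

lemma cycle_dist_le_path_length:
  assumes p: "is_path n (cycle_graph n) i j p" and i: "i \<in> {1..n}"
  shows "cycle_dist n i j \<le> length p - 1"
proof -
  have "cycle_dist n i (p ! k) \<le> k" if "k < length p" for k
    using that
  proof (induction k)
    case 0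
    then show ?case using p by (auto simp: is_path_def hd_conv_nth cycle_dist_def)
  next
    case (Suc k)
    have "cycle_dist n i (p ! Suc k) \<le> Suc (cycle_dist n i (p ! k))"
    proof (rule cycle_dist_step[OF i])
      have "set p \<subseteq> {1..n}"
        using p by (simp add: is_path_def)
      moreover have "p ! k \<in> set p" "p ! Suc k \<in> set p"
        using Suc.prems by simp_all
      ultimately show "p ! k \<in> {1..n}" "p ! Suc k \<in> {1..n}"
        by (simp_all only: subset_eq)
      show "{p ! k, p ! Suc k} \<in> cycle_graph n"
        using p Suc.prems by (simp add: is_path_def)
    qed
    with Suc show ?case by simp
  qed
  from this[of "length p - 1"] p show ?thesis
    by (auto simp: is_path_def last_conv_nth)
qed

lemma exists_path_of_cycle_dist:
  assumes "1 \<le> i" "i \<le> j" "j \<le> n"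
  shows "\<exists>p. is_path n (cycle_graph n) i j p \<and> length p - 1 = cycle_dist n i j"
proof (cases "2 * (j - i) \<le> n")
  case True
  have "is_path n (cycle_graph n) i j [i..<Suc j]"
    unfolding is_path_def cycle_graph_def using assms by (auto simp del: upt_Suc)
  moreover have "cycle_dist n i j = j - i"
    using True assms by (auto simp: cycle_dist_def)
  ultimately show ?thesis
    using assms by (intro exI[of _ "[i..<Suc j]"]) (simp del: upt_Suc)
next
  case False
  \<comment> \<open>The arc through the closing edge: down from \<open>i\<close> to
    \<open>1\<close>, across to \<open>n\<close>, down to \<open>j\<close>, in
    \<open>n - (j - i)\<close> steps. The cases below place step \<open>k\<close> before, at or
    after the crossing.\<close>
  let ?q = "rev [1..<Suc i] @ rev [j..<Suc n]"
  have ij: "i < j" using False by simp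
  have "{?q ! k, ?q ! Suc k} \<in> cycle_graph n" if k: "Suc k < length ?q" for k
  proof -
    consider "Suc k < i" | "Suc k = i" | "Suc k > i" by linarith
    then show ?thesis
    proof cases
      case 1
      then have "?q ! k = i - k" "?q ! Suc k = i - Suc k"
        by (auto simp: nth_append rev_nth simp del: upt_Suc)
      with 1 ij assms show ?thesis
        unfolding cycle_graph_def by (intro UnI1 CollectI exI[of _ "i - Suc k"]) auto
    next
      case 2
      then have "?q ! k = 1" "?q ! Suc k = n"
        using assms by (auto simp: nth_append rev_nth simp del: upt_Suc)
      then show ?thesis by (simp add: cycle_graph_def insert_commute)
    next
      case 3
      then have "?q ! k = n - (k - i)" "?q ! Suc k = n - Suc (k - i)"
        using k assms by (auto simp: nth_append rev_nth simp del: upt_Suc)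
      with 3 k ij assms show ?thesis
        unfolding cycle_graph_def
        by (intro UnI1 CollectI exI[of _ "n - Suc (k - i)"]) (auto simp del: upt_Suc)
    qed
  qed
  then have "is_path n (cycle_graph n) i j ?q"
    unfolding is_path_def using assms ij
    by (auto simp: hd_append hd_rev last_rev simp del: upt_Suc)
  moreover have "length ?q - 1 = cycle_dist n i j"
    using False assms by (auto simp: cycle_dist_def simp del: upt_Suc)
  ultimately show ?thesis by blast
qed

lemma graph_dist_cycle_graph:
  assumes "i \<in> {1..n}" "j \<in> {1..n}"
  shows "graph_dist n (cycle_graph n) i j = enat (cycle_dist n i j)"
proof -
  \<comment> \<open>Both sides are symmetric in the vertices, so ordered pairs suffice.\<close>
  have "graph_dist n (cycle_graph n) i j = enat (cycle_dist n i j)"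
    if "1 \<le> i" "i \<le> j" "j \<le> n" for i j
  proof (rule antisym)
    obtain p where p: "is_path n (cycle_graph n) i j p" "length p - 1 = cycle_dist n i j"
      using exists_path_of_cycle_dist[OF \<open>1 \<le> i\<close> \<open>i \<le> j\<close> \<open>j \<le> n\<close>] by blast
    then show "graph_dist n (cycle_graph n) i j \<le> enat (cycle_dist n i j)"
      unfolding graph_dist_def by (intro INF_lower2[of p]) auto
    show "enat (cycle_dist n i j) \<le> graph_dist n (cycle_graph n) i j"
      unfolding graph_dist_def
      using that cycle_dist_le_path_length[of n i j] by (intro INF_greatest) auto
  qed
  then show ?thesis
    using assms by (metis atLeastAtMost_iff cycle_dist_sym graph_dist_sym nle_le)
qed

subsection \<open>Resistance\<close>

text \<open>The term \<open>- k (n - k) / (2 n)\<close> has the second differences of a Green function of the cycle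
  Laplacian; the constant makes the values sum to \<open>0\<close> over a period.\<close>

definition cycle_green :: "nat \<Rightarrow> int \<Rightarrow> real" where
  "cycle_green n x = (real n ^ 2 - 1) / (12 * real n)
     - of_int (x mod int n) * (real n - of_int (x mod int n)) / (2 * real n)"

lemma cycle_green_periodic: "cycle_green n (x + int n) = cycle_green n x"
  by (simp add: cycle_green_def)

text \<open>The quadratic vanishes at \<open>0\<close> and at \<open>n\<close>, so the formula
  without \<open>mod\<close> extends to the right end point. This covers \<open>y + 1 = n\<close> in
  the second difference.\<close>

lemma cycle_green_eq:
  assumes "0 \<le> x" "x \<le> int n" "n > 0"
  shows "cycle_green n x
    = (real n ^ 2 - 1) / (12 * real n) - of_int x * (real n - of_int x) / (2 * real n)"
  using assms by (cases "x = int n") (auto simp: cycle_green_def)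

lemma cycle_green_minus:
  assumes "n > 0"
  shows "cycle_green n (- x) = cycle_green n x"
  using assms by (cases "x mod int n = 0") (auto simp: cycle_green_def zmod_zminus1_eq_if)

text \<open>Inside a period the quadratic has constant second difference, giving
  \<open>- 1 / n\<close>. At a multiple of \<open>n\<close> two parabolas meet in a corner, which
  adds \<open>1\<close>.\<close>

lemma cycle_green_second_difference:
  assumes "n > 0"
  shows "2 * cycle_green n x - cycle_green n (x + 1) - cycle_green n (x - 1)
    = of_bool (int n dvd x) - 1 / real n"
proof -
  define y where "y = x mod int n"
  have y: "0 \<le> y" "y < int n" using assms by (auto simp: y_def)
  have red: "cycle_green n (x + z) = cycle_green n (y + z)" for z
    by (simp add: cycle_green_def y_def mod_simps)
  have "int n dvd x \<longleftrightarrow> y = 0" by (simp add: y_def dvd_eq_mod_eq_0)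
  moreover have "2 * cycle_green n y - cycle_green n (y + 1) - cycle_green n (y - 1)
    = of_bool (y = 0) - 1 / real n"
  proof (cases "y = 0")
    case True
    \<comment> \<open>The argument \<open>y - 1 = - 1\<close> lies outside the range of
      \<open>cycle_green_eq\<close>; evenness replaces its value by that at
      \<open>1\<close>.\<close>
    have "cycle_green n 0 = cycle_green n 1 + (real n - 1) / (2 * real n)"
      using assms by (simp add: cycle_green_eq)
    then have "2 * cycle_green n y - cycle_green n (y + 1) - cycle_green n (y - 1)
        = 2 * ((real n - 1) / (2 * real n))"
      using True cycle_green_minus[OF assms, of 1] by simp
    also have "\<dots> = of_bool (y = 0) - 1 / real n"
      using True assms by (simp add: field_simps)
    finally show ?thesis .
  next
    case False
    with y assms show ?thesis
      by (simp add: cycle_green_eq field_simps)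
  qed
  ultimately show ?thesis
    using red[of 0] red[of 1] red[of "-1"] by simp
qed

lemma int_dvd_diff_iff:
  assumes "i < n" "j < n"
  shows "int n dvd int i - int j \<longleftrightarrow> i = j"
  using assms
  by (metis mod_eq_dvd_iff mod_pos_pos_trivial of_nat_0_le_iff of_nat_eq_iff of_nat_less_iff)

text \<open>A shift by one trades the last term for an equal one at the front.\<close>

lemma sum_shift_periodic:
  fixes f :: "int \<Rightarrow> 'a::comm_monoid_add"
  assumes per: "\<And>x. f (x + int n) = f x"
  shows "(\<Sum>i<n. f (int i - int j)) = (\<Sum>i<n. f (int i))"
proof (induction j)
  case (Suc j)
  have "(\<Sum>i<n. f (int i - int (Suc j))) = (\<Sum>i<n. f (int i - int j))"
  proof (cases n)
    case (Suc m)
    have "f (- 1 - int j) = f (int m - int j)"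
      using per[of "- 1 - int j"] Suc by (simp add: algebra_simps)
    then show ?thesis
      unfolding Suc
      by (subst sum.lessThan_Suc_shift, subst sum.lessThan_Suc)
         (simp add: add.commute algebra_simps)
  qed simp
  with Suc show ?case by simp
qed simp

text \<open>The parameter \<open>a\<close> is kept apart from \<open>m\<close> so that the induction
  can vary the bound alone; it is used with both equal to \<open>n\<close>.\<close>

lemma sum_times_complement:
  "6 * (\<Sum>k<m. real k * (a - real k)) = real m * (real m - 1) * (3 * a - 2 * real m + 1)"
  by (induction m) (auto simp: algebra_simps power2_eq_square)

text \<open>The quadratic terms add up to \<open>(n^2 - 1) / 12\<close> over a period, which is
  \<open>n\<close> times the constant in \<open>cycle_green\<close>.\<close>

lemma sum_cycle_green:
  assumes "n > 0"
  shows "(\<Sum>i<n. cycle_green n (int i)) = 0"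
proof -
  have "(\<Sum>i<n. cycle_green n (int i))
      = (\<Sum>i<n. (real n ^ 2 - 1) / (12 * real n) - real i * (real n - real i) / (2 * real n))"
    by (intro sum.cong) (auto simp: cycle_green_eq)
  also have "\<dots> = real n * ((real n ^ 2 - 1) / (12 * real n))
      - (\<Sum>i<n. real i * (real n - real i)) / (2 * real n)"
    by (simp add: sum_subtractf sum_divide_distrib)
  also have "(\<Sum>i<n. real i * (real n - real i))
      = real n * (real n - 1) * (3 * real n - 2 * real n + 1) / 6"
    using sum_times_complement[of "real n" n] by simp
  finally show ?thesis
    using assms by (simp add: field_simps power2_eq_square)
qed

section \<open>The Laplacian matrix and its pseudoinverse\<close>

definition cycle_green_matrix :: "nat \<Rightarrow> real mat" where
  "cycle_green_matrix n = mat n n (\<lambda>(i, j). cycle_green n (int i - int j))"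

text \<open>The orthogonal projection onto the vectors with coordinate sum zero.\<close>

definition centering_matrix :: "nat \<Rightarrow> real mat" where
  "centering_matrix n = mat n n (\<lambda>(i, j). of_bool (i = j) - 1 / real n)"

lemma centering_matrix_carrier [simp]: "centering_matrix n \<in> carrier_mat n n"
  by (simp add: centering_matrix_def)

lemma cycle_green_matrix_carrier [simp]: "cycle_green_matrix n \<in> carrier_mat n n"
  by (simp add: cycle_green_matrix_def)

lemma laplacian_carrier [simp]: "laplacian n E \<in> carrier_mat n n"
  unfolding laplacian_def by (intro minus_carrier_mat adj_matrix_carrier)

lemma laplacian_cycle_graph_index:
  assumes "n \<ge> 3" "i < n" "j < n"
  shows "laplacian n (cycle_graph n) $$ (i, j)
    = 2 * of_bool (i = j) - of_bool ({i + 1, j + 1} \<in> cycle_graph n)"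
  using assms degree_cycle_graph[OF assms(1,2)]
  by (cases "i = j") (simp_all add: laplacian_def adj_matrix_index)

lemma mat_mult_index_sum:
  assumes "A \<in> carrier_mat n m" "B \<in> carrier_mat m k" "i < n" "j < k"
  shows "(A * B) $$ (i, j) = (\<Sum>l<m. A $$ (i, l) * B $$ (l, j))"
  using assms by (auto simp: scalar_prod_def atLeast0LessThan intro!: sum.cong)

lemma laplacian_cycle_graph_times_periodic:
  fixes f :: "int \<Rightarrow> real"
  assumes "n \<ge> 3" "i < n" and per: "\<And>x. f (x + int n) = f x"
  shows "(\<Sum>l<n. laplacian n (cycle_graph n) $$ (i, l) * f (int l))
    = 2 * f (int i) - f (int i + 1) - f (int i - 1)"
proof -
  have "(\<Sum>l<n. laplacian n (cycle_graph n) $$ (i, l) * f (int l))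
      = (\<Sum>l<n. (if l = i then 2 * f (int i) else 0)
          - of_bool ({i + 1, l + 1} \<in> cycle_graph n) * f (int l))"
    using assms by (intro sum.cong) (auto simp: laplacian_cycle_graph_index algebra_simps)
  also have "\<dots> = 2 * f (int i) - (f (int i + 1) + f (int i - 1))"
    using sum_neighbours_cycle_graph_periodic[OF assms(1,2), of f] per assms(2)
    by (simp add: sum_subtractf)
  finally show ?thesis by simp
qed

text \<open>Column \<open>j\<close> is the Green function shifted by \<open>j\<close>, and the
  Laplacian acts on it as a negated second difference; the corner falls on the diagonal.\<close>

lemma laplacian_times_green:
  assumes "n \<ge> 3"
  shows "laplacian n (cycle_graph n) * cycle_green_matrix n = centering_matrix n"
proof (rule eq_matI)
  fix i j assume "i < dim_row (centering_matrix n)" "j < dim_col (centering_matrix n)"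
  then have ij: "i < n" "j < n" by (simp_all add: centering_matrix_def)
  have "(laplacian n (cycle_graph n) * cycle_green_matrix n) $$ (i, j)
      = (\<Sum>l<n. laplacian n (cycle_graph n) $$ (i, l) * cycle_green n (int l - int j))"
    by (subst mat_mult_index_sum[of _ n n _ n]) (use ij in \<open>auto simp: cycle_green_matrix_def\<close>)
  also have "\<dots> = 2 * cycle_green n (int i - int j) - cycle_green n (int i - int j + 1)
      - cycle_green n (int i - int j - 1)"
    using laplacian_cycle_graph_times_periodic[OF assms ij(1), of "\<lambda>x. cycle_green n (x - int j)"]
      cycle_green_periodic[of n "_ - int j"] by (simp add: algebra_simps)
  also have "\<dots> = of_bool (int n dvd int i - int j) - 1 / real n"
    using assms by (intro cycle_green_second_difference) simp
  also have "int n dvd int i - int j \<longleftrightarrow> i = j"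
    by (rule int_dvd_diff_iff[OF ij])
  finally show "(laplacian n (cycle_graph n) * cycle_green_matrix n) $$ (i, j)
      = centering_matrix n $$ (i, j)"
    using ij by (simp add: centering_matrix_def)
qed (auto simp: centering_matrix_def cycle_green_matrix_def laplacian_def)

lemma transpose_laplacian: "transpose_mat (laplacian n E) = laplacian n E"
  by (rule eq_matI) (auto simp: laplacian_def adj_matrix_def insert_commute)

lemma transpose_cycle_green_matrix:
  assumes "n > 0"
  shows "transpose_mat (cycle_green_matrix n) = cycle_green_matrix n"
proof (rule eq_matI)
  fix i j assume "i < dim_row (cycle_green_matrix n)" "j < dim_col (cycle_green_matrix n)"
  then show "transpose_mat (cycle_green_matrix n) $$ (i, j) = cycle_green_matrix n $$ (i, j)"
    using cycle_green_minus[OF assms, of "int i - int j"] by (simp add: cycle_green_matrix_def)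
qed (simp_all add: cycle_green_matrix_def)

lemma transpose_centering_matrix: "transpose_mat (centering_matrix n) = centering_matrix n"
  by (rule eq_matI) (auto simp: centering_matrix_def)

lemma centering_matrix_mult_left:
  assumes M: "M \<in> carrier_mat n n" and cols: "\<And>j. j < n \<Longrightarrow> (\<Sum>i<n. M $$ (i, j)) = 0"
  shows "centering_matrix n * M = M"
proof (rule eq_matI)
  fix i j assume "i < dim_row M" "j < dim_col M"
  then have ij: "i < n" "j < n" using M by auto
  have "(centering_matrix n * M) $$ (i, j)
      = (\<Sum>l<n. (if l = i then M $$ (i, j) else 0) - M $$ (l, j) / real n)"
    by (subst mat_mult_index_sum[of _ n n _ n])
       (use M ij in \<open>auto simp: centering_matrix_def algebra_simps intro!: sum.cong\<close>)
  also have "\<dots> = M $$ (i, j) - (\<Sum>l<n. M $$ (l, j)) / real n"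
    using ij by (simp add: sum_subtractf sum_divide_distrib)
  finally show "(centering_matrix n * M) $$ (i, j) = M $$ (i, j)"
    using cols ij by simp
qed (use M in \<open>auto simp: centering_matrix_def\<close>)

text \<open>Both products equal the symmetric centering matrix, so the Penrose conditions reduce to
  its fixing \<open>?L\<close> and \<open>?X\<close> from the left. Each of the two has zero column
  sums.\<close>

lemma pseudoinverse_laplacian_cycle_graph:
  assumes "n \<ge> 3"
  shows "pseudoinverse (laplacian n (cycle_graph n)) = cycle_green_matrix n"
proof (rule pseudoinverse_eqI)
  let ?L = "laplacian n (cycle_graph n)" and ?X = "cycle_green_matrix n"
  have n: "n > 0" using assms by simp
  have LX: "?L * ?X = centering_matrix n"
    by (rule laplacian_times_green[OF assms])
  \<comment> \<open>Both factors are symmetric, so transposing swaps them and yields the other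
    product.\<close>
  have "transpose_mat (?L * ?X) = ?X * ?L"
    using transpose_mult[OF laplacian_carrier cycle_green_matrix_carrier, of n "cycle_graph n"]
    by (simp add: transpose_laplacian transpose_cycle_green_matrix[OF n])
  then have XL: "?X * ?L = centering_matrix n"
    by (simp add: LX transpose_centering_matrix)
  have "centering_matrix n * ?L = ?L"
  proof (rule centering_matrix_mult_left)
    fix j assume j: "j < n"
    have "(\<Sum>i<n. ?L $$ (i, j)) = (\<Sum>i<n. ?L $$ (j, i) * 1)"
      using assms j
      by (intro sum.cong) (auto simp: laplacian_cycle_graph_index insert_commute)
    then show "(\<Sum>i<n. ?L $$ (i, j)) = 0"
      using laplacian_cycle_graph_times_periodic[OF assms j, of "\<lambda>_. 1"] by simp
  qed simp
  moreover have "centering_matrix n * ?X = ?X"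
  proof (rule centering_matrix_mult_left)
    fix j assume j: "j < n"
    have "(\<Sum>i<n. ?X $$ (i, j)) = (\<Sum>i<n. cycle_green n (int i - int j))"
      using j by (intro sum.cong) (auto simp: cycle_green_matrix_def)
    also have "\<dots> = 0"
      using sum_cycle_green[OF n] sum_shift_periodic[of "cycle_green n" n, OF cycle_green_periodic] by simp
    finally show "(\<Sum>i<n. ?X $$ (i, j)) = 0" .
  qed simp
  ultimately show "is_pseudoinverse ?L ?X"
    unfolding is_pseudoinverse_def
    using carrier_matD[OF laplacian_carrier[of n "cycle_graph n"]]
    by (simp add: LX XL transpose_centering_matrix)
qed

text \<open>Reflection and a shift by \<open>n\<close> carry \<open>i - j\<close> to either arc
  length. This reduces both the resistance and the Katz index to functions of the distance.\<close>

lemma eq_cycle_dist: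
  fixes f :: "int \<Rightarrow> 'a"
  assumes "i \<in> {1..n}" "j \<in> {1..n}"
    and per: "\<And>x. f (x + int n) = f x" and even: "\<And>x. f (- x) = f x"
  shows "f (int i - int j) = f (int (cycle_dist n i j))"
proof -
  have 1: "f (int i - int j) = f \<bar>int i - int j\<bar>"
    using even[of "int i - int j"] by (simp add: abs_if)
  have 2: "f \<bar>int i - int j\<bar> = f (int n - \<bar>int i - int j\<bar>)"
    using per[of "- \<bar>int i - int j\<bar>"] even[of "\<bar>int i - int j\<bar>"] by simp
  have "int (cycle_dist n i j) = \<bar>int i - int j\<bar>
      \<or> int (cycle_dist n i j) = int n - \<bar>int i - int j\<bar>"
    using assms(1,2) by (auto simp: cycle_dist_def)
  with 1 2 show ?thesis by metis
qed

lemma cycle_dist_le: "2 * cycle_dist n i j \<le> n"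
  by (auto simp: cycle_dist_def)

text \<open>The additive constant of the Green function cancels. The value is that of two arcs of
  resistance \<open>d\<close> and \<open>n - d\<close> in parallel.\<close>

lemma resistance_cycle_graph:
  assumes "n \<ge> 3" "i \<in> {1..n}" "j \<in> {1..n}"
  shows "resistance n (cycle_graph n) i j
    = real (cycle_dist n i j) * (real n - real (cycle_dist n i j)) / real n"
proof -
  have n: "n > 0" using assms by simp
  have green: "cycle_green_matrix n $$ (a - 1, b - 1) = cycle_green n (int a - int b)"
    if "a \<in> {1..n}" "b \<in> {1..n}" for a b
    using that by (auto simp: cycle_green_matrix_def of_nat_diff)
  have "resistance n (cycle_graph n) i j
      = 2 * cycle_green n 0 - 2 * cycle_green n (int i - int j)"
    unfolding resistance_def Let_def pseudoinverse_laplacian_cycle_graph[OF assms(1)]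
    using assms by (simp only: green) simp
  also have "cycle_green n (int i - int j) = cycle_green n (int (cycle_dist n i j))"
    by (rule eq_cycle_dist[OF assms(2,3) cycle_green_periodic cycle_green_minus[OF n]])
  finally show ?thesis
    using cycle_dist_le[of n i j] n by (simp add: cycle_green_eq diff_divide_distrib)
qed

subsection \<open>Katz index\<close>

text \<open>Counts the sequences of \<open>t\<close> steps, each plus or minus one, from
  \<open>x\<close> to a multiple of \<open>n\<close>.\<close>

fun cycle_walks :: "nat \<Rightarrow> nat \<Rightarrow> int \<Rightarrow> nat" where
  "cycle_walks n 0 x = of_bool (int n dvd x)"
| "cycle_walks n (Suc t) x = cycle_walks n t (x - 1) + cycle_walks n t (x + 1)"

lemma cycle_walks_periodic: "cycle_walks n t (x + int n) = cycle_walks n t x"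
proof (induction t arbitrary: x)
  case (Suc t)
  show ?case using Suc[of "x - 1"] Suc[of "x + 1"] by (simp add: algebra_simps)
qed simp

lemma cycle_walks_minus: "cycle_walks n t (- x) = cycle_walks n t x"
proof (induction t arbitrary: x)
  case (Suc t)
  have "- x - 1 = - (x + 1)" "- x + 1 = - (x - 1)" by simp_all
  then show ?case unfolding cycle_walks.simps by (simp only: Suc add.commute)
qed simp

text \<open>Two choices per step; compared with a geometric series, this gives convergence for
  \<open>\<alpha> < 1 / 2\<close>.\<close>

lemma cycle_walks_le: "cycle_walks n t x \<le> 2 ^ t"
proof (induction t arbitrary: x)
  case (Suc t)
  show ?case using Suc[of "x - 1"] Suc[of "x + 1"] by simp
qed simp

text \<open>Stepping down \<open>t\<close> times leads from \<open>t\<close> to \<open>0\<close>.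
  This provides the positive term in the resolvent series at \<open>k\<close>.\<close>

lemma cycle_walks_diagonal_pos: "cycle_walks n t (int t) > 0"
  by (induction t) auto

lemma adj_matrix_cycle_graph_pow_index:
  assumes "n \<ge> 3" "i < n" "j < n"
  shows "(adj_matrix n (cycle_graph n) ^\<^sub>m t) $$ (i, j) = real (cycle_walks n t (int i - int j))"
  using assms(2,3)
proof (induction t arbitrary: i j)
  case 0
  then show ?case by (simp add: int_dvd_diff_iff)
next
  case (Suc t)
  let ?A = "adj_matrix n (cycle_graph n)"
  have "(?A ^\<^sub>m Suc t) $$ (i, j) = (\<Sum>l<n. (?A ^\<^sub>m t) $$ (i, l) * ?A $$ (l, j))"
    unfolding pow_mat.simps
    by (rule mat_mult_index_sum[of _ n n _ n]) (use Suc.prems in auto)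
  \<comment> \<open>The power splits off its last factor on the right; symmetry of edges turns that
    column into a sum over the neighbours of \<open>j\<close>.\<close>
  also have "\<dots> = (\<Sum>l<n. of_bool ({j + 1, l + 1} \<in> cycle_graph n)
      * real (cycle_walks n t (int i - int l)))"
    using Suc by (intro sum.cong) (auto simp: adj_matrix_index insert_commute)
  also have "\<dots> = real (cycle_walks n t (int i - (int j + 1)))
      + real (cycle_walks n t (int i - (int j - 1)))"
  proof (rule sum_neighbours_cycle_graph_periodic[OF assms(1) Suc.prems(2)])
    show "real (cycle_walks n t (int i - (x + int n))) = real (cycle_walks n t (int i - x))" for x
      using cycle_walks_periodic[of n t "int i - (x + int n)"] by simp
  qed
  finally show ?case by (simp add: algebra_simps)
qed

text \<open>Unlike the Katz series, this sum starts with the term of exponent \<open>0\<close>; the two agree off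
  the diagonal.\<close>

definition cycle_resolvent :: "nat \<Rightarrow> real \<Rightarrow> int \<Rightarrow> real" where
  "cycle_resolvent n \<alpha> x = (\<Sum>t. \<alpha> ^ t * real (cycle_walks n t x))"

context
  fixes \<alpha> :: real
  assumes \<alpha>: "0 < \<alpha>" "\<alpha> < 1 / 2"
begin

lemma summable_cycle_resolvent: "summable (\<lambda>t. \<alpha> ^ t * real (cycle_walks n t x))"
proof (rule summable_comparison_test')
  show "summable (\<lambda>t. (2 * \<alpha>) ^ t)"
    using \<alpha> by (intro summable_geometric) simp
  fix t
  have "real (cycle_walks n t x) \<le> 2 ^ t"
    using cycle_walks_le[of n t x] by (metis of_nat_le_iff of_nat_numeral of_nat_power)
  then show "norm (\<alpha> ^ t * real (cycle_walks n t x)) \<le> (2 * \<alpha>) ^ t"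
    using \<alpha> by (simp add: power_mult_distrib mult.commute abs_mult mult_right_mono)
qed

lemma cycle_resolvent_unfold:
  "cycle_resolvent n \<alpha> x = of_bool (int n dvd x)
    + (\<Sum>t. \<alpha> ^ Suc t * real (cycle_walks n (Suc t) x))"
  using suminf_split_head[OF summable_cycle_resolvent, of n x]
  by (simp add: cycle_resolvent_def)

text \<open>The entrywise form of \<open>G = I + \<alpha> A G\<close>.\<close>

lemma cycle_resolvent_recurrence:
  "cycle_resolvent n \<alpha> x = of_bool (int n dvd x)
    + \<alpha> * (cycle_resolvent n \<alpha> (x - 1) + cycle_resolvent n \<alpha> (x + 1))"
proof -
  have "(\<Sum>t. \<alpha> ^ Suc t * real (cycle_walks n (Suc t) x))
      = (\<Sum>t. \<alpha> * (\<alpha> ^ t * real (cycle_walks n t (x - 1)) + \<alpha> ^ t * real (cycle_walks n t (x + 1))))"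
    by (simp add: algebra_simps)
  also have "\<dots> = \<alpha> * (cycle_resolvent n \<alpha> (x - 1) + cycle_resolvent n \<alpha> (x + 1))"
    unfolding cycle_resolvent_def
    by (simp add: suminf_mult summable_add suminf_add summable_cycle_resolvent)
  finally show ?thesis using cycle_resolvent_unfold by simp
qed

lemma cycle_resolvent_pos: "cycle_resolvent n \<alpha> (int k) > 0"
  unfolding cycle_resolvent_def
  by (rule suminf_pos2[OF summable_cycle_resolvent, of _ _ k])
     (use \<alpha> cycle_walks_diagonal_pos[of n k] in auto)

lemma cycle_resolvent_periodic: "cycle_resolvent n \<alpha> (x + int n) = cycle_resolvent n \<alpha> x"
  by (simp add: cycle_resolvent_def cycle_walks_periodic)

lemma cycle_resolvent_minus: "cycle_resolvent n \<alpha> (- x) = cycle_resolvent n \<alpha> x"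
  by (simp add: cycle_resolvent_def cycle_walks_minus)

lemma cycle_resolvent_strict_convex:
  assumes "0 < k" "k < n"
  shows "2 * cycle_resolvent n \<alpha> (int k)
    < cycle_resolvent n \<alpha> (int k - 1) + cycle_resolvent n \<alpha> (int k + 1)"
proof -
  let ?s = "cycle_resolvent n \<alpha> (int k - 1) + cycle_resolvent n \<alpha> (int k + 1)"
  \<comment> \<open>No multiple of \<open>n\<close> lies strictly between \<open>0\<close> and
    \<open>n\<close>, so the identity term of the recurrence vanishes.\<close>
  have "\<not> int n dvd int k" using assms by (simp add: nat_dvd_not_less)
  then have eq: "cycle_resolvent n \<alpha> (int k) = \<alpha> * ?s"
    using cycle_resolvent_recurrence[of n "int k"] by simp
  then have "?s > 0"
    using cycle_resolvent_pos[of n k] \<alpha> by (simp add: zero_less_mult_iff)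
  then have "\<alpha> * ?s < 1 / 2 * ?s"
    using \<alpha> by (intro mult_strict_right_mono) auto
  with eq show ?thesis by simp
qed

text \<open>Strict convexity makes the decrements decrease, and the symmetry \<open>k \<mapsto> n - k\<close> sends the
  decrement at \<open>k\<close> to minus the decrement at \<open>n - 1 - k\<close>.\<close>

lemma cycle_resolvent_decreasing_step:
  assumes "2 * Suc k \<le> n"
  shows "cycle_resolvent n \<alpha> (int (Suc k)) < cycle_resolvent n \<alpha> (int k)"
proof -
  define D where "D = (\<lambda>k. cycle_resolvent n \<alpha> (int k) - cycle_resolvent n \<alpha> (int (Suc k)))"
  have step: "D (Suc m) < D m" if "Suc m < n" for m
    using cycle_resolvent_strict_convex[of "Suc m" n] that by (simp add: D_def algebra_simps)
  have less: "D (k + Suc m) < D k" if "k + Suc m < n" for m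
    using that
  proof (induction m)
    case 0
    then show ?case using step[of k] by simp
  next
    case (Suc m)
    then show ?case using step[of "k + Suc m"] by simp
  qed
  have sym: "cycle_resolvent n \<alpha> (int (n - m)) = cycle_resolvent n \<alpha> (int m)" if "m \<le> n" for m
    using cycle_resolvent_periodic[of n "- int m"] cycle_resolvent_minus[of n "int m"] that
    by (simp add: of_nat_diff)
  have "D (n - 1 - k) = - D k"
    using sym[of k] sym[of "Suc k"] assms by (simp add: D_def Suc_diff_Suc)
  \<comment> \<open>Since \<open>2 * Suc k \<le> n\<close>, the mirrored index exceeds
    \<open>k\<close> and the subtractions are exact. A decrement larger than its own negative is
    positive.\<close>
  moreover have "D (n - 1 - k) < D k"
  proof -
    have "k + Suc (n - 1 - k - k - 1) = n - 1 - k" using assms by simp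
    with less[of "n - 1 - k - k - 1"] assms show ?thesis by simp
  qed
  ultimately show ?thesis by (simp add: D_def)
qed

lemma cycle_resolvent_strict_antimono:
  assumes "a < b" "2 * b \<le> n"
  shows "cycle_resolvent n \<alpha> (int b) < cycle_resolvent n \<alpha> (int a)"
  using assms
proof (induction b)
  case (Suc b)
  have "cycle_resolvent n \<alpha> (int (Suc b)) < cycle_resolvent n \<alpha> (int b)"
    by (rule cycle_resolvent_decreasing_step) (use Suc in simp)
  with Suc show ?case by (cases "a = b") auto
qed simp

lemma katz_cycle_graph:
  assumes "n \<ge> 3" "i \<in> {1..n}" "j \<in> {1..n}" "i \<noteq> j"
  shows "katz n (cycle_graph n) \<alpha> i j = cycle_resolvent n \<alpha> (int (cycle_dist n i j))"
proof -
  let ?A = "adj_matrix n (cycle_graph n)"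
  have ij: "i - 1 < n" "j - 1 < n" "int (i - 1) - int (j - 1) = int i - int j"
    using assms by auto
  have entry: "(\<alpha> ^ Suc t \<cdot>\<^sub>m ?A ^\<^sub>m Suc t) $$ (i - 1, j - 1)
      = \<alpha> ^ Suc t * real (cycle_walks n (Suc t) (int i - int j))" for t
  proof -
    have "?A ^\<^sub>m Suc t \<in> carrier_mat n n" by (rule pow_carrier_mat) simp
    then show ?thesis
      using adj_matrix_cycle_graph_pow_index[OF assms(1) ij(1,2), of "Suc t"] ij
      by (simp del: pow_mat.simps cycle_walks.simps power_Suc)
  qed
  \<comment> \<open>For distinct vertices the term of exponent \<open>0\<close> is zero, so the Katz
    series sums to the resolvent entry.\<close>
  have "\<not> int n dvd int i - int j"
    using int_dvd_diff_iff[OF ij(1,2)] ij(3) assms by auto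
  then have "katz n (cycle_graph n) \<alpha> i j = cycle_resolvent n \<alpha> (int i - int j)"
    unfolding katz_def katz_matrix_def using ij(1,2)
    by (simp only: index_mat entry prod.case cycle_resolvent_unfold of_bool_eq add_0)
  also have "\<dots> = cycle_resolvent n \<alpha> (int (cycle_dist n i j))"
    by (rule eq_cycle_dist[OF assms(2,3) cycle_resolvent_periodic cycle_resolvent_minus])
  finally show ?thesis .
qed

end

section \<open>Comparison of the three rankings\<close>

lemma times_complement_strict_mono:
  fixes a b c :: real
  assumes "a < b" "2 * b \<le> c"
  shows "a * (c - a) < b * (c - b)"
proof -
  \<comment> \<open>The difference of the two sides factors in this way; \<open>a < b\<close> and
    \<open>2 * b \<le> c\<close> make both factors positive.\<close>
  have "0 < (b - a) * (c - a - b)"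
    using assms by (intro mult_pos_pos) auto
  then show ?thesis by (simp add: algebra_simps)
qed

text \<open>The Katz equivalence concerns pairs of distinct vertices: for small
  \<open>\<alpha>\<close> a diagonal entry of the series is of order \<open>\<alpha> ^ 2\<close>,
  below the order \<open>\<alpha>\<close> of an edge, although its distance is
  \<open>0\<close>.\<close>

theorem theorem2:
  fixes n i j i' j' :: nat and \<alpha> :: real
  assumes "n \<ge> 3"
    and "0 < \<alpha>" and "\<alpha> < 1 / graph_spectral_radius n (cycle_graph n)"
    and "i \<in> {1..n}" and "j \<in> {1..n}" and "i' \<in> {1..n}" and "j' \<in> {1..n}"
  shows "(i \<noteq> j \<and> i' \<noteq> j' \<longrightarrow>
            (katz n (cycle_graph n) \<alpha> i j < katz n (cycle_graph n) \<alpha> i' j' \<longleftrightarrow>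
             resistance n (cycle_graph n) i j > resistance n (cycle_graph n) i' j')) \<and>
         (resistance n (cycle_graph n) i j > resistance n (cycle_graph n) i' j' \<longleftrightarrow>
          graph_dist n (cycle_graph n) i j > graph_dist n (cycle_graph n) i' j')"
proof -
  define d d' where "d = cycle_dist n i j" and "d' = cycle_dist n i' j'"
  have d: "2 * d \<le> n" "2 * d' \<le> n"
    by (simp_all add: d_def d'_def cycle_dist_le)
  have "1 / graph_spectral_radius n (cycle_graph n) \<le> 1 / 2"
    using graph_spectral_radius_cycle_graph_ge[OF assms(1)] by (intro divide_left_mono) auto
  then have \<alpha>: "0 < \<alpha>" "\<alpha> < 1 / 2" using assms(2,3) by auto
  have "resistance n (cycle_graph n) i j > resistance n (cycle_graph n) i' j' \<longleftrightarrow>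
      real d' * (real n - real d') < real d * (real n - real d)"
    using assms by (simp add: resistance_cycle_graph d_def d'_def divide_less_cancel)
  also have "\<dots> \<longleftrightarrow> d' < d"
    using times_complement_strict_mono[of "real d'" "real d" "real n"]
      times_complement_strict_mono[of "real d" "real d'" "real n"] d
    by (cases d d' rule: linorder_cases) auto
  finally have res: "resistance n (cycle_graph n) i j > resistance n (cycle_graph n) i' j' \<longleftrightarrow> d' < d" .
  have dist: "graph_dist n (cycle_graph n) i j > graph_dist n (cycle_graph n) i' j' \<longleftrightarrow> d' < d"
    using assms by (simp add: graph_dist_cycle_graph d_def d'_def)
  \<comment> \<open>Trichotomy of the distances turns strict monotonicity into an equivalence; equal
    distances give equal indices.\<close>
  have "katz n (cycle_graph n) \<alpha> i j < katz n (cycle_graph n) \<alpha> i' j' \<longleftrightarrow> d' < d"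
    if "i \<noteq> j" "i' \<noteq> j'"
    using that assms katz_cycle_graph[OF \<alpha>, of n i j] katz_cycle_graph[OF \<alpha>, of n i' j']
      cycle_resolvent_strict_antimono[OF \<alpha>, of d d' n]
      cycle_resolvent_strict_antimono[OF \<alpha>, of d' d n] d
    unfolding d_def d'_def
    by (cases "cycle_dist n i j" "cycle_dist n i' j'" rule: linorder_cases) auto
  with res dist show ?thesis by blast
qed

end
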